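(* Let $p,q\in[1,\infty]$. Then the Wiener amalgam norm $\lVert\cdot\rVert_{W(L^p,l^q)}$ is equivalent to a rearrangement-invariant norm if and only if $p=q$, in which case it is the classical Lebesgue norm $\lVert\cdot\rVert_p$.
   Context: $\lambda$ is Lebesgue measure on $[0,\infty)$; $M$ is the set of extended complex-valued $\lambda$-measurable functions on $[0,\infty)$ (identified when equal a.e.); $\mathbb N$ contains $0$. For $p,q\in[1,\infty]$ and $f\in M$, $\lVert f\rVert_{W(L^p,l^q)}=\big(\sum_{n=0}^\infty\lVert f\chi_{[n,n+1)}\rVert_{L^p}^q\big)^{1/q}$ if $q<\infty$ and $\lVert f\rVert_{W(L^p,l^\infty)}=\sup_{n\in\mathbb N}\lVert f\chi_{[n,n+1)}\rVert_{L^p}$. A functional $N:M\to[0,\infty]$ is rearrangement-invariant if $N(f)=N(g)$ whenever $\lambda(\{|f|>s\})=\lambda(\{|g|>s\})$ for all $s\ge0$. Functionals $N_1,N_2:M\to[0,\infty]$ are equivalent if there is $C_0\in(0,\infty)$ with $C_0^{-1}N_1(f)\le N_2(f)\le C_0N_1(f)$ for all $f\in M$. *)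

theory Defs
  imports "HOL-Analysis.Analysis" "HOL-Probability.Essential_Supremum"
begin

text \<open>
  The extended complex numbers, i.e. the complex numbers with one point at infinity.  The
  conventions at infinity are the ones that extend the arithmetic of \<open>[0, \<infinity>]\<close>: a sum with an
  infinite summand is infinite, and \<open>0 \<cdot> \<infinity> = 0\<close>.
\<close>

datatype ecomplex = Fin complex | Infty

instantiation ecomplex :: "{zero, plus, times}"
begin

definition zero_ecomplex :: ecomplex where
  "0 = Fin 0"

fun plus_ecomplex :: "ecomplex \<Rightarrow> ecomplex \<Rightarrow> ecomplex" where
  "Fin a + Fin b = Fin (a + b)"
| "Infty + _ = Infty"
| "Fin _ + Infty = Infty"

fun times_ecomplex :: "ecomplex \<Rightarrow> ecomplex \<Rightarrow> ecomplex" where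
  "Fin a * Fin b = Fin (a * b)"
| "Infty * y = (if y = 0 then 0 else Infty)"
| "Fin a * Infty = (if a = 0 then 0 else Infty)"

instance ..

end

fun modulus :: "ecomplex \<Rightarrow> ennreal" where
  "modulus (Fin a) = ennreal (cmod a)"
| "modulus Infty = top"

text \<open>
  The Borel sets of the one-point compactification of the plane are exactly the sets whose finite
  part is Borel.
\<close>

definition ecomplex_borel :: "ecomplex measure" where
  "ecomplex_borel = sigma UNIV {S. Fin -` S \<in> sets borel}"

abbreviation lam :: "real measure" where
  "lam \<equiv> lebesgue_on {0..}"

text \<open>
  Elements of \<open>M\<close> are represented by functions on the whole line whose values outside \<open>[0, \<infinity>)\<close>
  are irrelevant.  The identification of functions that agree a.e. is not built into the type; it
  is expressed by requiring functionals to respect it.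
\<close>

definition M :: "(real \<Rightarrow> ecomplex) set" where
  "M = lam \<rightarrow>\<^sub>M ecomplex_borel"

definition respects_ae :: "((real \<Rightarrow> ecomplex) \<Rightarrow> ennreal) \<Rightarrow> bool" where
  "respects_ae N \<longleftrightarrow> (\<forall>f\<in>M. \<forall>g\<in>M. (AE x in lam. f x = g x) \<longrightarrow> N f = N g)"

definition norm_on_M :: "((real \<Rightarrow> ecomplex) \<Rightarrow> ennreal) \<Rightarrow> bool" where
  "norm_on_M N \<longleftrightarrow> respects_ae N \<and>
     (\<forall>a. \<forall>f\<in>M. N (\<lambda>x. Fin a * f x) = ennreal (cmod a) * N f) \<and>
     (\<forall>f\<in>M. N f = 0 \<longleftrightarrow> (AE x in lam. f x = 0)) \<and>
     (\<forall>f\<in>M. \<forall>g\<in>M. N (\<lambda>x. f x + g x) \<le> N f + N g)"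

definition rearrangement_invariant :: "((real \<Rightarrow> ecomplex) \<Rightarrow> ennreal) \<Rightarrow> bool" where
  "rearrangement_invariant N \<longleftrightarrow> (\<forall>f\<in>M. \<forall>g\<in>M.
     (\<forall>s::real. s \<ge> 0 \<longrightarrow>
        emeasure lam {x \<in> {0..}. modulus (f x) > ennreal s} =
        emeasure lam {x \<in> {0..}. modulus (g x) > ennreal s})
     \<longrightarrow> N f = N g)"

definition equivalent ::
    "((real \<Rightarrow> ecomplex) \<Rightarrow> ennreal) \<Rightarrow> ((real \<Rightarrow> ecomplex) \<Rightarrow> ennreal) \<Rightarrow> bool" where
  "equivalent N1 N2 \<longleftrightarrow> (\<exists>C0::real. C0 > 0 \<and>
     (\<forall>f\<in>M. ennreal (inverse C0) * N1 f \<le> N2 f \<and> N2 f \<le> ennreal C0 * N1 f))"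

text \<open>Powers on \<open>[0, \<infinity>]\<close>, intended for exponents \<open>r > 0\<close> only.\<close>

definition epow :: "ennreal \<Rightarrow> real \<Rightarrow> ennreal" where
  "epow x r = (if x = top then top else ennreal (enn2real x powr r))"

definition Lp_norm :: "ennreal \<Rightarrow> (real \<Rightarrow> ecomplex) \<Rightarrow> ennreal" where
  "Lp_norm p f =
     (if p = top then esssup lam (\<lambda>x. modulus (f x))
      else epow (\<integral>\<^sup>+ x. epow (modulus (f x)) (enn2real p) \<partial>lam) (1 / enn2real p))"

definition chi :: "real set \<Rightarrow> real \<Rightarrow> ecomplex" where
  "chi E x = Fin (indicator E x)"

definition amalgam_norm :: "ennreal \<Rightarrow> ennreal \<Rightarrow> (real \<Rightarrow> ecomplex) \<Rightarrow> ennreal" where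
  "amalgam_norm p q f =
     (if q = top then (SUP n::nat. Lp_norm p (\<lambda>x. f x * chi {real n..<real n + 1} x))
      else epow (\<Sum>n::nat. epow (Lp_norm p (\<lambda>x. f x * chi {real n..<real n + 1} x)) (enn2real q))
             (1 / enn2real q))"

end

theory Submission
  imports Defs
begin

text \<open>
  For \<open>n > 0\<close>, the set \<open>\<Union>k<n. [k, k + 1/n)\<close> has measure 1, like \<open>[0, 1)\<close>, so their indicators are
  rearrangements of each other, whereas the amalgam norm of the former is \<open>n powr (1/q - 1/p)\<close>
  and that of the latter is 1.  Hence an equivalent rearrangement-invariant functional forces
  \<open>p = q\<close>.  Conversely, for \<open>p = q\<close> the amalgam norm is the Lebesgue norm, which is a
  norm by Minkowski's inequality and rearrangement-invariant by the layer cake formula.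
\<close>

section \<open>Powers on [0, \<infinity>]\<close>

lemma epow_top [simp]: "epow top r = top"
  by (simp add: epow_def)

lemma epow_ennreal [simp]: "0 \<le> a \<Longrightarrow> epow (ennreal a) r = ennreal (a powr r)"
  by (simp add: epow_def)

text \<open>Every exponent is allowed because \<open>0 powr r\<close> is 0, even for
  \<open>r = 0\<close>.\<close>

lemma epow_eq_0_iff [simp]: "epow x r = 0 \<longleftrightarrow> x = 0"
  by (cases x) (auto simp: epow_def ennreal_eq_0_iff)

lemma epow_mono: "x \<le> y \<Longrightarrow> 0 \<le> r \<Longrightarrow> epow x r \<le> epow y r"
  by (cases x; cases y) (auto simp: powr_mono2 top_unique)

lemma epow_epow: "epow (epow x r) s = epow x (r * s)"
  by (cases x) (auto simp: powr_powr)

lemma epow_1 [simp]: "epow x 1 = x"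
  by (cases x) auto

lemma epow_mult: "0 < r \<Longrightarrow> epow (x * y) r = epow x r * epow y r"
  by (cases x; cases y)
     (auto simp: powr_mult ennreal_mult[symmetric] ennreal_mult_top ennreal_top_mult)

text \<open>Turns level sets of a power of |f| into level sets of |f|, which is how the layer cake
  formula is fed with the distribution function.\<close>

lemma less_epow_iff:
  assumes "0 \<le> s" "0 < r"
  shows "ennreal s < epow x r \<longleftrightarrow> ennreal (s powr (1 / r)) < x"
proof (cases x)
  case (real a)
  have "s < a powr r \<longleftrightarrow> s powr (1 / r) < a"
    using assms real powr_less_mono2[of "1 / r" s "a powr r"] powr_less_mono2[of r "s powr (1 / r)" a]
    by (auto simp: powr_powr)
  then show ?thesis using real assms by (simp add: ennreal_less_iff)
qed (simp add: assms)

lemma borel_measurable_epow [measurable]: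
  assumes [measurable]: "f \<in> borel_measurable \<mu>"
  shows "(\<lambda>x. epow (f x) r) \<in> borel_measurable \<mu>"
  unfolding epow_def by measurable

section \<open>Minkowski's inequality\<close>

text \<open>Convexity of the r-th power: (x + y) / (a + b) is the convex combination of x / a and y
  / b with weights a / (a + b) and b / (a + b). The numbers \<open>a\<close> and \<open>b\<close>
  will be bounds for the two norms.\<close>

lemma powr_add_le:
  fixes a b x y r :: real
  assumes "1 \<le> r" "0 < a" "0 < b" "0 \<le> x" "0 \<le> y"
  shows "(x + y) powr r \<le> (a + b) powr r * (a / (a + b) * (x / a) powr r + b / (a + b) * (y / b) powr r)"
proof -
  define t where "t = b / (a + b)"
  have t: "0 < t" "t < 1" "a / (a + b) = 1 - t"
    using assms by (auto simp: t_def field_simps)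
  \<comment> \<open>Convexity is invoked on the open half-line only; if \<open>u\<close> or
    \<open>v\<close> is 0, the claim reduces to this inequality for the weight of the other
    point.\<close>
  have pow_le: "c powr r \<le> c" if "0 < c" "c < 1" for c :: real
    using powr_mono'[of 1 r c] that assms by simp
  have conv: "((1 - t) * u + t * v) powr r \<le> (1 - t) * u powr r + t * v powr r"
    if uv: "0 \<le> u" "0 \<le> v" for u v
  proof -
    consider "u = 0" | "v = 0" | "0 < u" "0 < v" using uv by fastforce
    then show ?thesis
    proof cases
      case 1
      then show ?thesis using t pow_le[of t] uv by (simp add: powr_mult mult_right_mono)
    next
      case 2
      then show ?thesis using t pow_le[of "1 - t"] uv by (simp add: powr_mult mult_right_mono)
    next
      case 3
      then show ?thesis
        using convex_onD[OF powr_convex[OF assms(1)], of t u v] t by simp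
    qed
  qed
  have "x + y = (a + b) * ((1 - t) * (x / a) + t * (y / b))"
  proof -
    have "(a + b) * (1 - t) = a" "(a + b) * t = b"
      using assms by (simp_all add: t_def field_simps)
    then have "(a + b) * ((1 - t) * (x / a) + t * (y / b)) = a * (x / a) + b * (y / b)"
      by (simp add: distrib_left mult.assoc[symmetric] del: times_divide_eq_right)
    then show ?thesis using assms by simp
  qed
  then have "(x + y) powr r = (a + b) powr r * ((1 - t) * (x / a) + t * (y / b)) powr r"
    by (simp only: powr_mult)
  also have "\<dots> \<le> (a + b) powr r * ((1 - t) * (x / a) powr r + t * (y / b) powr r)"
    using assms by (intro mult_left_mono conv) auto
  finally show ?thesis by (simp add: t(3)) (simp add: t_def)
qed

text \<open>Integrating \<open>powr_add_le\<close> pointwise bounds each normalized integral by 1,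
  and the convex weights add up to 1. Strict positivity of \<open>a\<close> and \<open>b\<close>
  makes the normalization possible.\<close>

lemma nn_integral_epow_add_le:
  fixes a b r :: real
  assumes [measurable]: "F \<in> borel_measurable \<mu>" "G \<in> borel_measurable \<mu>"
    and "1 \<le> r" "0 < a" "0 < b"
    and F: "(\<integral>\<^sup>+x. epow (F x) r \<partial>\<mu>) \<le> ennreal (a powr r)"
    and G: "(\<integral>\<^sup>+x. epow (G x) r \<partial>\<mu>) \<le> ennreal (b powr r)"
  shows "(\<integral>\<^sup>+x. epow (F x + G x) r \<partial>\<mu>) \<le> ennreal ((a + b) powr r)"
proof -
  \<comment> \<open>\<open>A\<close> and \<open>B\<close> are the coefficients of
    \<open>x powr r\<close> and \<open>y powr r\<close> in \<open>powr_add_le\<close>, with the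
    normalizing factors pulled out. They are positive, so an infinite argument makes both sides of
    \<open>le\<close> infinite.\<close>
  define A where "A = (a + b) powr r * (a / (a + b)) / a powr r"
  define B where "B = (a + b) powr r * (b / (a + b)) / b powr r"
  have pos: "0 < A" "0 < B" using assms by (auto simp: A_def B_def)
  have le: "epow (x + y) r \<le> ennreal A * epow x r + ennreal B * epow y r" for x y
  proof (cases x; cases y)
    fix u v assume *: "0 \<le> u" "x = ennreal u" "0 \<le> v" "y = ennreal v"
    have "(u + v) powr r \<le> A * u powr r + B * v powr r"
      using powr_add_le[of r a b u v] assms *
      by (simp add: A_def B_def powr_divide field_simps)
    then show ?thesis
      using * pos by (simp add: ennreal_mult[symmetric] ennreal_plus[symmetric] del: ennreal_plus)
  qed (use pos in \<open>auto simp: ennreal_mult_top\<close>)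
  have "(\<integral>\<^sup>+x. epow (F x + G x) r \<partial>\<mu>)
      \<le> (\<integral>\<^sup>+x. ennreal A * epow (F x) r + ennreal B * epow (G x) r \<partial>\<mu>)"
    by (intro nn_integral_mono le)
  also have "\<dots> = ennreal A * (\<integral>\<^sup>+x. epow (F x) r \<partial>\<mu>) + ennreal B * (\<integral>\<^sup>+x. epow (G x) r \<partial>\<mu>)"
    by (simp add: nn_integral_add nn_integral_cmult)
  also have "\<dots> \<le> ennreal A * ennreal (a powr r) + ennreal B * ennreal (b powr r)"
    by (intro add_mono mult_left_mono F G) auto
  also have "\<dots> = ennreal (A * a powr r + B * b powr r)"
    using pos by (simp add: ennreal_mult)
  also have "A * a powr r + B * b powr r = (a + b) powr r * (a / (a + b) + b / (a + b))"
  proof -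
    have "A * a powr r = (a + b) powr r * (a / (a + b))" "B * b powr r = (a + b) powr r * (b / (a + b))"
      using assms by (simp_all add: A_def B_def)
    then show ?thesis by (simp add: distrib_left)
  qed
  also have "a / (a + b) + b / (a + b) = 1"
    using assms by (simp add: add_divide_distrib[symmetric])
  finally show ?thesis by simp
qed

text \<open>The two norms may vanish, so each is enlarged by e / 2 to obtain the strictly positive
  bounds of \<open>nn_integral_epow_add_le\<close>; then e tends to 0.\<close>

lemma nn_integral_Minkowski:
  fixes r :: real
  assumes "F \<in> borel_measurable \<mu>" "G \<in> borel_measurable \<mu>" and "1 \<le> r"
  shows "epow (\<integral>\<^sup>+x. epow (F x + G x) r \<partial>\<mu>) (1 / r)
    \<le> epow (\<integral>\<^sup>+x. epow (F x) r \<partial>\<mu>) (1 / r) + epow (\<integral>\<^sup>+x. epow (G x) r \<partial>\<mu>) (1 / r)"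
    (is "?L \<le> ?A + ?B")
proof (rule ennreal_le_epsilon)
  fix e :: real assume "?A + ?B < top" "0 < e"
  then obtain a b where a: "0 \<le> a" "?A = ennreal a" and b: "0 \<le> b" "?B = ennreal b"
    by (cases ?A; cases ?B) auto
  have upper: "X \<le> ennreal ((c + e / 2) powr r)" if "epow X (1 / r) = ennreal c" "0 \<le> c" for X c
  proof -
    have "X = epow (epow X (1 / r)) r"
      using assms by (simp add: epow_epow)
    also have "\<dots> \<le> ennreal ((c + e / 2) powr r)"
      using that \<open>0 < e\<close> assms by (simp add: powr_mono2)
    finally show ?thesis .
  qed
  have "(\<integral>\<^sup>+x. epow (F x + G x) r \<partial>\<mu>) \<le> ennreal ((a + e / 2 + (b + e / 2)) powr r)"
    using assms a b \<open>0 < e\<close> by (intro nn_integral_epow_add_le upper) auto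
  then have "?L \<le> epow (ennreal ((a + e / 2 + (b + e / 2)) powr r)) (1 / r)"
    using assms by (intro epow_mono) auto
  also have "\<dots> = ?A + ?B + e"
    using a b \<open>0 < e\<close> assms
    by (simp add: powr_powr ennreal_plus[symmetric] algebra_simps del: ennreal_plus)
  finally show "?L \<le> ?A + ?B + e" .
qed

section \<open>The layer cake formula\<close>

text \<open>Tonelli for the region \<open>A\<close> under the graph of \<open>F\<close>: its section
  over \<open>x\<close> has length \<open>F x\<close>, its section at height \<open>t\<close> is the
  superlevel set of \<open>F\<close>.\<close>

lemma nn_integral_layer_cake:
  assumes "sigma_finite_measure \<mu>" and [measurable]: "F \<in> borel_measurable \<mu>"
  shows "(\<integral>\<^sup>+x. F x \<partial>\<mu>)
    = (\<integral>\<^sup>+t. indicator {0..} t * emeasure \<mu> {x \<in> space \<mu>. ennreal t < F x} \<partial>lborel)"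
proof -
  interpret sigma_finite_measure \<mu> by fact
  interpret pair_sigma_finite \<mu> lborel ..
  define A where "A = {(x, t). x \<in> space \<mu> \<and> 0 \<le> t \<and> ennreal t < F x}"
  have "A = {z \<in> space (\<mu> \<Otimes>\<^sub>M lborel). 0 \<le> snd z \<and> ennreal (snd z) < F (fst z)}"
    by (auto simp: A_def space_pair_measure)
  also have "\<dots> \<in> sets (\<mu> \<Otimes>\<^sub>M lborel)" by measurable
  finally have A: "A \<in> sets (\<mu> \<Otimes>\<^sub>M lborel)" .
  have inner: "(\<integral>\<^sup>+t. indicator A (x, t) \<partial>lborel) = F x" if "x \<in> space \<mu>" for x
  proof (cases "F x")
    case (real r)
    then have "(indicator A (x, t) :: ennreal) = indicator {0..<r} t" for t
      using that by (auto simp: A_def indicator_def ennreal_less_iff)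
    then have "(\<integral>\<^sup>+t. indicator A (x, t) \<partial>lborel) = (\<integral>\<^sup>+t. indicator {0..<r} t \<partial>lborel)"
      by (simp only:)
    then show ?thesis using real by simp
  next
    case top
    then have "(indicator A (x, t) :: ennreal) = indicator {0..} t" for t
      using that by (auto simp: A_def indicator_def)
    then have "(\<integral>\<^sup>+t. indicator A (x, t) \<partial>lborel) = (\<integral>\<^sup>+t. indicator {0::real..} t \<partial>lborel)"
      by (simp only:)
    also have "\<dots> = emeasure lborel {0::real..}" by simp
    also have "\<dots> = top"
    proof (cases "emeasure lborel {0::real..}")
      case (real c)
      \<comment> \<open>If the half-line had finite measure c, its subset [0, c + 1] would be larger
        than it.\<close>
      have "ennreal (c + 1) = emeasure lborel {0..c + 1}" using real by simp
      also have "\<dots> \<le> emeasure lborel {0::real..}" by (intro emeasure_mono) auto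
      finally show ?thesis using real by simp
    qed
    finally show ?thesis using top by simp
  qed
  have outer: "(\<integral>\<^sup>+x. indicator A (x, t) \<partial>\<mu>)
      = indicator {0..} t * emeasure \<mu> {x \<in> space \<mu>. ennreal t < F x}" for t
  proof (cases "0 \<le> t")
    case True
    have "(\<integral>\<^sup>+x. indicator A (x, t) \<partial>\<mu>)
        = (\<integral>\<^sup>+x. indicator {x \<in> space \<mu>. ennreal t < F x} x \<partial>\<mu>)"
      using True by (intro nn_integral_cong) (auto simp: A_def indicator_def)
    then show ?thesis using True by simp
  qed (simp add: A_def)
  have "(\<integral>\<^sup>+x. F x \<partial>\<mu>) = (\<integral>\<^sup>+x. \<integral>\<^sup>+t. indicator A (x, t) \<partial>lborel \<partial>\<mu>)"
    by (intro nn_integral_cong) (simp add: inner)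
  also have "\<dots> = (\<integral>\<^sup>+t. \<integral>\<^sup>+x. indicator A (x, t) \<partial>\<mu> \<partial>lborel)"
    using A by (intro Fubini'[symmetric]) simp
  finally show ?thesis by (simp add: outer)
qed

lemma sigma_finite_lam: "sigma_finite_measure lam"
proof (rule sigma_finite_measure_restrict_space)
  show "sigma_finite_measure (lebesgue :: real measure)"
  proof
    show "\<exists>A::real set set. countable A \<and> A \<subseteq> sets lebesgue \<and> \<Union> A = space lebesgue
        \<and> (\<forall>a\<in>A. emeasure lebesgue a \<noteq> \<infinity>)"
    proof (intro exI[of _ "range (\<lambda>n::nat. {- real n..real n})"] conjI ballI)
      show "\<Union> (range (\<lambda>n::nat. {- real n..real n})) = space lebesgue"
      proof (intro equalityI subsetI)
        fix x :: real
        obtain n :: nat where "\<bar>x\<bar> \<le> n" using real_arch_simple by blast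
        then show "x \<in> \<Union> (range (\<lambda>n::nat. {- real n..real n}))" by (auto intro!: exI[of _ n])
      qed auto
    qed auto
  qed
qed simp

section \<open>Measurability and modulus on the extended complex plane\<close>

text \<open>Preimages commute with complements and countable unions, so the generating family is
  already a sigma-algebra.\<close>

lemma sets_ecomplex_borel: "sets ecomplex_borel = {S. Fin -` S \<in> sets borel}"
proof -
  have "sigma_algebra UNIV {S. Fin -` S \<in> sets borel}"
    by (auto simp: sigma_algebra_iff2 vimage_Diff vimage_UN intro!: sets.countable_UN)
  then show ?thesis
    by (simp add: ecomplex_borel_def sigma_algebra.sigma_sets_eq)
qed

lemma space_ecomplex_borel [simp]: "space ecomplex_borel = UNIV"
  by (simp add: ecomplex_borel_def)

lemma measurable_ecomplex_borelI:
  assumes "\<And>S. Fin -` S \<in> sets borel \<Longrightarrow> f -` S \<inter> space \<mu> \<in> sets \<mu>"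
  shows "f \<in> \<mu> \<rightarrow>\<^sub>M ecomplex_borel"
  using assms by (intro measurableI) (auto simp: sets_ecomplex_borel)

text \<open>Whether a set contains \<open>Infty\<close> does not affect its measurability, so only
  the finite part of \<open>h\<close> has to be examined.\<close>

lemma measurable_from_ecomplex_borel:
  assumes "space \<mu> = UNIV" "(\<lambda>z. h (Fin z)) \<in> borel \<rightarrow>\<^sub>M \<mu>"
  shows "h \<in> ecomplex_borel \<rightarrow>\<^sub>M \<mu>"
proof (rule measurableI)
  fix A assume "A \<in> sets \<mu>"
  from measurable_sets[OF assms(2) this]
  show "h -` A \<inter> space ecomplex_borel \<in> sets ecomplex_borel"
    by (simp add: sets_ecomplex_borel vimage_def)
qed (simp add: assms)

lemma measurable_modulus: "modulus \<in> borel_measurable ecomplex_borel"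
  by (rule measurable_from_ecomplex_borel) auto

lemma measurable_modulus_M [measurable (raw)]:
  "f \<in> M \<Longrightarrow> (\<lambda>x. modulus (f x)) \<in> borel_measurable lam"
  unfolding M_def using measurable_compose measurable_modulus by blast

lemma M_chi: "E \<in> sets lebesgue \<Longrightarrow> chi E \<in> M"
proof -
  assume E: "E \<in> sets lebesgue"
  have "Fin \<in> borel \<rightarrow>\<^sub>M ecomplex_borel"
    by (intro measurable_ecomplex_borelI) auto
  moreover have "(\<lambda>x. indicator E x :: complex) \<in> borel_measurable lam"
    using E by (intro measurable_restrict_space1 borel_measurable_indicator) auto
  ultimately show ?thesis
    unfolding M_def chi_def by (rule measurable_compose[rotated])
qed

lemma modulus_eq_0_iff [simp]: "modulus a = 0 \<longleftrightarrow> a = 0"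
  by (cases a) (auto simp: zero_ecomplex_def)

lemma modulus_add: "modulus (a + b) \<le> modulus a + modulus b"
  by (cases a; cases b) (auto simp: ennreal_plus[symmetric] norm_triangle_ineq simp del: ennreal_plus)

lemma modulus_Fin_mult: "modulus (Fin a * b) = ennreal (cmod a) * modulus b"
  by (cases b) (auto simp: norm_mult ennreal_mult ennreal_mult_top zero_ecomplex_def)

lemma modulus_mult_chi: "modulus (a * chi E x) = modulus a * indicator E x"
  by (cases a) (auto simp: chi_def zero_ecomplex_def split: split_indicator)

lemma modulus_chi: "modulus (chi E x) = indicator E x"
  by (simp add: chi_def split: split_indicator)

lemma chi_mult_chi: "chi E x * chi F x = chi (E \<inter> F) x"
  by (simp add: chi_def split: split_indicator)

text \<open>The modulus of a sum is rewritten in terms of the two moduli and the complex-valued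
  finite parts, all of which are measurable.\<close>

lemma borel_measurable_modulus_add:
  assumes "f \<in> M" "g \<in> M"
  shows "(\<lambda>x. modulus (f x + g x)) \<in> borel_measurable lam"
proof -
  \<comment> \<open>The value at \<open>Infty\<close> is arbitrary: \<open>eq\<close> consults
    \<open>fin\<close> only where both moduli are finite.\<close>
  define fin where "fin a = (case a of Fin z \<Rightarrow> z | Infty \<Rightarrow> 0)" for a
  have fin: "(\<lambda>x. fin (h x)) \<in> borel_measurable lam" if "h \<in> M" for h
    using that unfolding M_def
    by (elim measurable_compose) (auto intro!: measurable_from_ecomplex_borel simp: fin_def)
  have eq: "modulus (a + b) = (if modulus a = top \<or> modulus b = top then top
      else ennreal (cmod (fin a + fin b)))" for a b
    by (cases a; cases b) (auto simp: fin_def)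
  note [measurable] = fin[OF assms(1)] fin[OF assms(2)] assms
  show ?thesis unfolding eq by measurable
qed

section \<open>Lebesgue norms: norm axioms and rearrangement invariance\<close>

lemma space_lam [simp]: "space lam = {0..}"
  by (simp add: space_restrict_space)

lemma enn2real_ge_1: "1 \<le> p \<Longrightarrow> p \<noteq> top \<Longrightarrow> 1 \<le> enn2real p"
  by (cases p) auto

lemma Lp_norm_triangle:
  assumes "1 \<le> p" and fg: "f \<in> M" "g \<in> M"
  shows "Lp_norm p (\<lambda>x. f x + g x) \<le> Lp_norm p f + Lp_norm p g"
proof (cases "p = top")
  case True
  have "AE x in lam. modulus (f x + g x)
      \<le> esssup lam (\<lambda>x. modulus (f x)) + esssup lam (\<lambda>x. modulus (g x))"
    using esssup_AE[of "\<lambda>x. modulus (f x)" lam] esssup_AE[of "\<lambda>x. modulus (g x)" lam]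
    by eventually_elim (meson add_mono modulus_add order_trans)
  then show ?thesis
    using True fg by (simp add: Lp_norm_def esssup_I borel_measurable_modulus_add)
next
  case False
  note r = enn2real_ge_1[OF assms(1) False]
  have "Lp_norm p (\<lambda>x. f x + g x)
      \<le> epow (\<integral>\<^sup>+x. epow (modulus (f x) + modulus (g x)) (enn2real p) \<partial>lam) (1 / enn2real p)"
    using r False unfolding Lp_norm_def
    by (auto intro!: epow_mono nn_integral_mono modulus_add)
  also have "\<dots> \<le> Lp_norm p f + Lp_norm p g"
    using nn_integral_Minkowski[OF measurable_modulus_M measurable_modulus_M r] fg False
    by (simp add: Lp_norm_def)
  finally show ?thesis .
qed

text \<open>The inequality \<le> holds for any constant and any measurable function; applied to
  \<open>1 / c\<close> and the scaled function it gives the converse.\<close>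

lemma esssup_ennreal_cmult:
  fixes F :: "'a \<Rightarrow> ennreal"
  assumes [measurable]: "F \<in> borel_measurable \<mu>" and "0 < c"
  shows "esssup \<mu> (\<lambda>x. ennreal c * F x) = ennreal c * esssup \<mu> F"
proof (rule antisym)
  have le: "esssup \<mu> (\<lambda>x. ennreal c * F x) \<le> ennreal c * esssup \<mu> F"
    if [measurable]: "F \<in> borel_measurable \<mu>" for c and F :: "'a \<Rightarrow> ennreal"
    using esssup_AE[of F \<mu>] by (intro esssup_I) (auto elim!: eventually_mono intro: mult_left_mono)
  then show "esssup \<mu> (\<lambda>x. ennreal c * F x) \<le> ennreal c * esssup \<mu> F" by simp
  have inv: "ennreal c * (ennreal (1 / c) * y) = y" "ennreal (1 / c) * (ennreal c * y) = y" for y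
    using \<open>0 < c\<close> by (simp_all add: mult.assoc[symmetric] ennreal_mult[symmetric])
  have "esssup \<mu> (\<lambda>x. ennreal (1 / c) * (ennreal c * F x))
      \<le> ennreal (1 / c) * esssup \<mu> (\<lambda>x. ennreal c * F x)"
    by (intro le) simp
  then have "esssup \<mu> F \<le> ennreal (1 / c) * esssup \<mu> (\<lambda>x. ennreal c * F x)"
    by (simp only: inv)
  then have "ennreal c * esssup \<mu> F
      \<le> ennreal c * (ennreal (1 / c) * esssup \<mu> (\<lambda>x. ennreal c * F x))"
    by (rule mult_left_mono) simp
  then show "ennreal c * esssup \<mu> F \<le> esssup \<mu> (\<lambda>x. ennreal c * F x)" by (simp only: inv)
qed

lemma Lp_norm_eq_0_iff:
  assumes "1 \<le> p" "f \<in> M"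
  shows "Lp_norm p f = 0 \<longleftrightarrow> (AE x in lam. f x = 0)"
proof (cases "p = top")
  case True
  have [measurable]: "(\<lambda>x. modulus (f x)) \<in> borel_measurable lam"
    using assms(2) by (rule measurable_modulus_M)
  have "esssup lam (\<lambda>x. modulus (f x)) = 0 \<longleftrightarrow> (AE x in lam. modulus (f x) \<le> 0)"
    using esssup_AE[of "\<lambda>x. modulus (f x)" lam] esssup_I[of "\<lambda>x. modulus (f x)" lam 0]
    by fastforce
  then show ?thesis using True by (simp add: Lp_norm_def)
next
  case False
  then show ?thesis
    using assms(2) by (simp add: Lp_norm_def nn_integral_0_iff_AE borel_measurable_epow measurable_modulus_M)
qed

lemma Lp_norm_scale:
  assumes "1 \<le> p" "f \<in> M"
  shows "Lp_norm p (\<lambda>x. Fin a * f x) = ennreal (cmod a) * Lp_norm p f"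
proof (cases "a = 0")
  case True
  have "Lp_norm p (chi {}) = 0"
    using assms(1) by (subst Lp_norm_eq_0_iff) (auto simp: M_chi chi_def zero_ecomplex_def)
  \<comment> \<open>Since 0 times \<open>Infty\<close> is 0, the product is the zero function
    everywhere, even where \<open>f\<close> is infinite.\<close>
  moreover have "(\<lambda>x. Fin a * f x) = chi {}"
  proof
    show "Fin a * f x = chi {} x" for x using True by (cases "f x") (auto simp: chi_def zero_ecomplex_def)
  qed
  ultimately show ?thesis using True by simp
next
  case False
  have [measurable]: "(\<lambda>x. modulus (f x)) \<in> borel_measurable lam"
    using assms(2) by (rule measurable_modulus_M)
  show ?thesis
  proof (cases "p = top")
    case True
    then show ?thesis
      using \<open>a \<noteq> 0\<close> by (simp add: Lp_norm_def modulus_Fin_mult esssup_ennreal_cmult)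
  next
    case False
    let ?r = "enn2real p"
    have r: "1 \<le> ?r" using enn2real_ge_1[OF assms(1) False] .
    have "(\<integral>\<^sup>+x. epow (modulus (Fin a * f x)) ?r \<partial>lam)
        = epow (ennreal (cmod a)) ?r * (\<integral>\<^sup>+x. epow (modulus (f x)) ?r \<partial>lam)"
      using r by (simp add: modulus_Fin_mult epow_mult nn_integral_cmult del: epow_ennreal)
    then show ?thesis
      using r False by (simp add: Lp_norm_def epow_mult epow_epow del: epow_ennreal)
  qed
qed

text \<open>The norm is a function of the distribution: for finite \<open>p\<close> by the layer
  cake formula for the \<open>p\<close>-th power of the modulus, for \<open>p = top\<close> because
  the essential supremum is determined by which superlevel sets are null.\<close>

lemma Lp_norm_cong_distribution:
  assumes "1 \<le> p" and fg: "f \<in> M" "g \<in> M"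
    and eq: "\<And>s::real. 0 \<le> s \<Longrightarrow> emeasure lam {x \<in> {0..}. ennreal s < modulus (f x)}
      = emeasure lam {x \<in> {0..}. ennreal s < modulus (g x)}"
  shows "Lp_norm p f = Lp_norm p g"
proof (cases "p = top")
  case True
  \<comment> \<open>The hypothesis covers finite thresholds; for \<open>z = top\<close> both sets
    are empty.\<close>
  have "emeasure lam {x \<in> {0..}. z < modulus (f x)} = emeasure lam {x \<in> {0..}. z < modulus (g x)}" for z
    using eq by (cases z) auto
  then show ?thesis
    using True fg by (simp add: Lp_norm_def esssup_eq measurable_modulus_M)
next
  case False
  note r = enn2real_ge_1[OF assms(1) False]
  have layer: "(\<integral>\<^sup>+x. epow (modulus (h x)) (enn2real p) \<partial>lam)
      = (\<integral>\<^sup>+t. indicator {0..} t *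
          emeasure lam {x \<in> {0..}. ennreal t < epow (modulus (h x)) (enn2real p)} \<partial>lborel)"
    if "h \<in> M" for h
    using nn_integral_layer_cake[OF sigma_finite_lam borel_measurable_epow[OF measurable_modulus_M[OF that]]]
    by simp
  have "(\<integral>\<^sup>+x. epow (modulus (f x)) (enn2real p) \<partial>lam) = (\<integral>\<^sup>+x. epow (modulus (g x)) (enn2real p) \<partial>lam)"
    unfolding layer[OF fg(1)] layer[OF fg(2)]
  proof (intro nn_integral_cong)
    fix t :: real
    show "indicator {0..} t * emeasure lam {x \<in> {0..}. ennreal t < epow (modulus (f x)) (enn2real p)}
        = indicator {0..} t * emeasure lam {x \<in> {0..}. ennreal t < epow (modulus (g x)) (enn2real p)}"
    proof (cases "0 \<le> t")
      case True
      then show ?thesis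
        using r eq[of "t powr (1 / enn2real p)"] by (simp add: less_epow_iff)
    qed simp
  qed
  then show ?thesis using False by (simp add: Lp_norm_def)
qed

lemma norm_on_M_Lp_norm:
  assumes "1 \<le> p"
  shows "norm_on_M (Lp_norm p)"
proof -
  have "respects_ae (Lp_norm p)"
    unfolding respects_ae_def
  proof (intro ballI impI)
    fix f g assume fg: "f \<in> M" "g \<in> M" "AE x in lam. f x = g x"
    show "Lp_norm p f = Lp_norm p g"
    \<comment> \<open>Functions that agree almost everywhere have the same distribution.\<close>
    proof (rule Lp_norm_cong_distribution[OF assms fg(1,2)])
      fix s :: real
      have [measurable]: "(\<lambda>x. modulus (f x)) \<in> borel_measurable lam"
        "(\<lambda>x. modulus (g x)) \<in> borel_measurable lam"
        using fg by (auto intro: measurable_modulus_M)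
      have "{x \<in> space lam. ennreal s < modulus (f x)} \<in> sets lam"
        "{x \<in> space lam. ennreal s < modulus (g x)} \<in> sets lam" by measurable
      then show "emeasure lam {x \<in> {0..}. ennreal s < modulus (f x)}
          = emeasure lam {x \<in> {0..}. ennreal s < modulus (g x)}"
        using fg(3) by (intro emeasure_eq_AE) (auto elim: eventually_mono)
    qed
  qed
  then show ?thesis
    using assms by (auto simp: norm_on_M_def Lp_norm_scale Lp_norm_eq_0_iff Lp_norm_triangle)
qed

lemma rearrangement_invariant_Lp_norm: "1 \<le> p \<Longrightarrow> rearrangement_invariant (Lp_norm p)"
  by (auto simp: rearrangement_invariant_def intro!: Lp_norm_cong_distribution)

section \<open>Splitting the half-line into unit intervals\<close>

text \<open>Expressing the index as a function of the point yields both disjointness and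
  covering.\<close>

lemma mem_unit_interval_iff: "x \<in> {real n..<real n + 1} \<longleftrightarrow> 0 \<le> x \<and> n = nat \<lfloor>x\<rfloor>"
  by (auto simp: floor_eq_iff le_floor_iff) linarith+

lemma disjoint_unit_intervals: "disjoint_family (\<lambda>n::nat. {real n..<real n + 1})"
  by (auto simp: disjoint_family_on_def simp del: atLeastLessThan_iff simp: mem_unit_interval_iff)

text \<open>For finite \<open>p\<close> the outer power undoes the root in each local norm, and
  countable additivity sums the integrals over the unit intervals. For \<open>p = top\<close> the
  countably many exceptional null sets unite to one null set.\<close>

lemma amalgam_norm_eq_Lp_norm:
  assumes "1 \<le> p" "f \<in> M"
  shows "amalgam_norm p p f = Lp_norm p f"
proof -
  let ?I = "\<lambda>n::nat. {real n..<real n + 1}"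
  have m [measurable]: "(\<lambda>x. modulus (f x)) \<in> borel_measurable lam"
    using assms(2) by (rule measurable_modulus_M)
  have [measurable]: "?I n \<in> sets lam" for n
    by (subst sets_restrict_space_iff) auto
  show ?thesis
  proof (cases "p = top")
    case True
    let ?S = "SUP n. esssup lam (\<lambda>x. modulus (f x) * indicator (?I n) x)"
    have "?S = esssup lam (\<lambda>x. modulus (f x))"
    proof (rule antisym)
      show "?S \<le> esssup lam (\<lambda>x. modulus (f x))"
        by (intro SUP_least esssup_mono) (auto split: split_indicator)
      have "AE x in lam. \<forall>n. modulus (f x) * indicator (?I n) x
          \<le> esssup lam (\<lambda>x. modulus (f x) * indicator (?I n) x)"
        unfolding AE_all_countable by (intro allI esssup_AE)
      then have "AE x in lam. modulus (f x) \<le> ?S"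
        using AE_space[of lam]
      proof eventually_elim
        case (elim x)
        have "modulus (f x) = modulus (f x) * indicator (?I (nat \<lfloor>x\<rfloor>)) x"
          using elim mem_unit_interval_iff[of x "nat \<lfloor>x\<rfloor>"] by simp
        also have "\<dots> \<le> ?S" using elim by (blast intro: SUP_upper2)
        finally show ?case .
      qed
      then show "esssup lam (\<lambda>x. modulus (f x)) \<le> ?S"
        by (intro esssup_I) auto
    qed
    then show ?thesis
      using True by (simp add: amalgam_norm_def Lp_norm_def modulus_mult_chi)
  next
    case False
    note r = enn2real_ge_1[OF assms(1) False]
    let ?F = "\<lambda>x. epow (modulus (f x)) (enn2real p)"
    have "(\<Sum>n. epow (Lp_norm p (\<lambda>x. f x * chi (?I n) x)) (enn2real p))
        = (\<Sum>n. \<integral>\<^sup>+x. ?F x * indicator (?I n) x \<partial>lam)"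
      using False r
      by (auto simp: Lp_norm_def epow_epow modulus_mult_chi
          intro!: suminf_cong nn_integral_cong split: split_indicator)
    also have "\<dots> = (\<integral>\<^sup>+x. (\<Sum>n. ?F x * indicator (?I n) x) \<partial>lam)"
      by (intro nn_integral_suminf[symmetric]) measurable
    also have "\<dots> = (\<integral>\<^sup>+x. ?F x \<partial>lam)"
    proof (intro nn_integral_cong)
      fix x assume "x \<in> space lam"
      then have "x \<in> ?I (nat \<lfloor>x\<rfloor>)" using mem_unit_interval_iff[of x "nat \<lfloor>x\<rfloor>"] by simp
      then show "(\<Sum>n. ?F x * indicator (?I n) x) = ?F x"
        using suminf_cmult_indicator[OF disjoint_unit_intervals, of x "nat \<lfloor>x\<rfloor>" "\<lambda>_. ?F x"] by simp
    qed
    finally show ?thesis using False by (simp add: amalgam_norm_def Lp_norm_def)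
  qed
qed

section \<open>Indicators and the comb sets\<close>

text \<open>One formula serves all \<open>p\<close>: \<open>enn2real top\<close> is 0 and
  \<open>1 / 0\<close> is 0, so for \<open>p = top\<close> the right-hand side is
  \<open>m powr 0\<close>, which is 1 as \<open>m\<close> is positive.\<close>

lemma Lp_norm_chi:
  assumes "1 \<le> p" and E: "E \<in> sets lam" "emeasure lam E = ennreal m" "0 < m"
  shows "Lp_norm p (chi E) = ennreal (m powr (1 / enn2real p))"
proof (cases "p = top")
  case True
  have [measurable]: "E \<in> sets lam" by fact
  have "esssup lam (\<lambda>x. indicator E x :: ennreal) = 1"
  proof (rule antisym)
    show "esssup lam (\<lambda>x. indicator E x :: ennreal) \<le> 1"
      by (intro esssup_I) (auto split: split_indicator)
    show "1 \<le> esssup lam (\<lambda>x. indicator E x :: ennreal)"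
    proof (rule ccontr)
      assume *: "\<not> 1 \<le> esssup lam (\<lambda>x. indicator E x :: ennreal)"
      \<comment> \<open>An essential supremum below 1 forces the indicator to vanish almost
        everywhere, but \<open>E\<close> has positive measure.\<close>
      have "AE x in lam. x \<notin> E"
        using esssup_AE[of "\<lambda>x. indicator E x :: ennreal" lam]
        by eventually_elim (use * in \<open>auto split: split_indicator_asm\<close>)
      then show False using E by (simp add: AE_iff_null_sets[symmetric] null_sets_def)
    qed
  qed
  then show ?thesis using True E by (simp add: Lp_norm_def modulus_chi)
next
  case False
  have "(\<integral>\<^sup>+x. epow (indicator E x) (enn2real p) \<partial>lam) = (\<integral>\<^sup>+x. indicator E x \<partial>lam)"
    by (intro nn_integral_cong) (auto split: split_indicator simp: epow_def)
  then show ?thesis using False E by (simp add: Lp_norm_def modulus_chi)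
qed

text \<open>Since \<open>comb 1\<close> is [0, 1), this family supplies both sets of the
  comparison.\<close>

definition comb :: "nat \<Rightarrow> real set" where
  "comb n = (\<Union>k<n. {real k..<real k + 1 / real n})"

lemma comb_in_sets [measurable]: "comb n \<in> sets lebesgue" "comb n \<in> sets lam"
  by (auto simp: comb_def sets_restrict_space_iff)

lemma comb_tooth_subset: "{real k..<real k + 1 / real n} \<subseteq> {real k..<real k + 1}"
proof -
  have "1 / real n \<le> 1" by (cases n) auto
  then show ?thesis by (intro ivl_subset[THEN iffD2]) simp
qed

text \<open>Tooth \<open>k\<close> lies inside the \<open>k\<close>-th unit interval, and these
  intervals are disjoint, so each one meets at most its own tooth.\<close>

lemma comb_Int:
  "comb n \<inter> {real j..<real j + 1} = (if j < n then {real j..<real j + 1 / real n} else {})"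
proof -
  have index: "k = j" if "x \<in> {real k..<real k + 1 / real n}" "x \<in> {real j..<real j + 1}" for k x
    using subsetD[OF comb_tooth_subset that(1)] that(2) by (simp only: mem_unit_interval_iff)
  have "x \<in> comb n \<inter> {real j..<real j + 1} \<longleftrightarrow> j < n \<and> x \<in> {real j..<real j + 1 / real n}" for x
  proof
    assume "x \<in> comb n \<inter> {real j..<real j + 1}"
    then obtain k where "k < n" "x \<in> {real k..<real k + 1 / real n}" "x \<in> {real j..<real j + 1}"
      unfolding comb_def by blast
    with index show "j < n \<and> x \<in> {real j..<real j + 1 / real n}" by blast
  next
    assume "j < n \<and> x \<in> {real j..<real j + 1 / real n}"
    then show "x \<in> comb n \<inter> {real j..<real j + 1}"
      using comb_tooth_subset[of j n] unfolding comb_def by blast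
  qed
  then show ?thesis by (cases "j < n") (simp_all only: set_eq_iff if_True if_False empty_iff simp_thms)
qed

lemma emeasure_comb:
  assumes "0 < n"
  shows "emeasure lam (comb n) = 1"
proof -
  have "disjoint_family_on (\<lambda>k. {real k..<real k + 1 / real n}) {..<n}"
    unfolding disjoint_family_on_def
  proof (intro ballI impI)
    fix k l :: nat assume "k \<noteq> l"
    then have "{real k..<real k + 1} \<inter> {real l..<real l + 1} = {}"
      using disjoint_unit_intervals by (simp only: disjoint_family_on_def) blast
    then show "{real k..<real k + 1 / real n} \<inter> {real l..<real l + 1 / real n} = {}"
      using comb_tooth_subset[of k n] comb_tooth_subset[of l n] by blast
  qed
  then have "emeasure lebesgue (comb n) = (\<Sum>k<n. emeasure lebesgue {real k..<real k + 1 / real n})"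
    unfolding comb_def by (intro sum_emeasure[symmetric]) auto
  also have "\<dots> = 1" using assms by (simp add: ennreal_of_nat_eq_real_of_nat ennreal_mult[symmetric])
  finally show ?thesis
    by (subst emeasure_restrict_space) (auto simp: comb_def)
qed

text \<open>Each of the first \<open>n\<close> unit intervals carries a tooth of length 1 / n, with
  local norm \<open>c\<close>, and the others contribute 0. The outer norm of \<open>n\<close> equal
  entries adds the factor \<open>n powr (1 / enn2real q)\<close>; the convention
  \<open>1 / enn2real top = 0\<close> covers infinite \<open>p\<close> and \<open>q\<close>.\<close>

lemma amalgam_norm_comb:
  assumes "1 \<le> p" "1 \<le> q" "0 < n"
  shows "amalgam_norm p q (chi (comb n)) = ennreal (real n powr (1 / enn2real q - 1 / enn2real p))"
proof -
  define c where "c = (1 / real n) powr (1 / enn2real p)"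
  have "Lp_norm p (\<lambda>x. chi (comb n) x * chi {real j..<real j + 1} x)
      = (if j < n then ennreal c else 0)" for j
  proof (cases "j < n")
    case True
    have "{real j..<real j + 1 / real n} \<in> sets lam"
      by (auto simp: sets_restrict_space_iff)
    moreover have "emeasure lam {real j..<real j + 1 / real n} = ennreal (1 / real n)"
      by (subst emeasure_restrict_space) auto
    ultimately show ?thesis
      using True assms Lp_norm_chi[OF assms(1)]
      by (simp add: chi_mult_chi comb_Int c_def)
  next
    case False
    have "Lp_norm p (chi {}) = 0"
      using assms(1) by (subst Lp_norm_eq_0_iff) (auto simp: M_chi chi_def zero_ecomplex_def)
    then show ?thesis using False by (simp add: chi_mult_chi comb_Int)
  qed
  note * = this
  have c: "0 \<le> c" by (simp add: c_def)
  show ?thesis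
  proof (cases "q = top")
    case True
    \<comment> \<open>The supremum is attained at index 0, which carries a tooth because
      \<open>n\<close> is positive.\<close>
    have "(SUP j. if j < n then ennreal c else 0) = ennreal c"
      using assms(3) by (intro antisym SUP_least SUP_upper2[of 0]) auto
    then show ?thesis
      using True by (simp add: amalgam_norm_def * c_def powr_divide powr_minus_divide)
  next
    case False
    note r = enn2real_ge_1[OF assms(2) False]
    have "(\<Sum>j. epow (if j < n then ennreal c else 0) (enn2real q))
        = (\<Sum>j<n. epow (if j < n then ennreal c else 0) (enn2real q))"
      by (intro suminf_finite) auto
    also have "\<dots> = ennreal (real n * c powr enn2real q)"
      using c by (simp add: ennreal_of_nat_eq_real_of_nat ennreal_mult[symmetric])
    finally have "amalgam_norm p q (chi (comb n)) = ennreal (real n powr (1 / enn2real q) * c)"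
      using False r c by (simp add: amalgam_norm_def * powr_mult powr_powr)
    then show ?thesis by (simp add: c_def powr_divide powr_diff)
  qed
qed

section \<open>Growth of powers and the characterization\<close>

lemma powr_unbounded:
  fixes d K :: real
  assumes "0 < d"
  obtains n :: nat where "0 < n" "K < real n powr d"
proof -
  obtain n :: nat where n: "(\<bar>K\<bar> + 1) powr (1 / d) < real n"
    using reals_Archimedean2 by blast
  then have "K < real n powr d"
    using powr_less_mono2[OF assms _ n] assms by (simp add: powr_powr)
  moreover have "0 < n"
    using n by (metis of_nat_0_less_iff order_le_less_trans powr_ge_zero)
  ultimately show ?thesis using that by blast
qed

theorem corollaryA5:
  fixes p q :: ennreal
  assumes "1 \<le> p" and "1 \<le> q"
  shows "((\<exists>N. norm_on_M N \<and> rearrangement_invariant N \<and> equivalent (amalgam_norm p q) N)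
            \<longleftrightarrow> p = q) \<and>
         (p = q \<longrightarrow> (\<forall>f\<in>M. amalgam_norm p q f = Lp_norm p f))"
proof (intro conjI iffI)
  assume "\<exists>N. norm_on_M N \<and> rearrangement_invariant N \<and> equivalent (amalgam_norm p q) N"
  then obtain N C where RI: "rearrangement_invariant N" and C: "0 < C"
    and lower: "\<And>f. f \<in> M \<Longrightarrow> ennreal (inverse C) * amalgam_norm p q f \<le> N f"
    and upper: "\<And>f. f \<in> M \<Longrightarrow> N f \<le> ennreal C * amalgam_norm p q f"
    by (auto simp: equivalent_def)
  define d where "d = 1 / enn2real q - 1 / enn2real p"
  \<comment> \<open>\<open>N\<close> takes the same value at \<open>comb n\<close> and
    \<open>comb 1\<close>. Its lower bound at one set and upper bound at the other, in both
    combinations, compare \<open>real n powr d\<close> with 1.\<close>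
  have bounds: "inverse C * real n powr d \<le> C" "inverse C \<le> C * real n powr d" if n: "0 < n" for n :: nat
  proof -
    have "{x \<in> {0..}. ennreal s < modulus (chi (comb k) x)} = (if s < 1 then comb k else {})"
      if "0 \<le> s" for s k
    proof -
      have "comb k \<subseteq> {0..}" by (auto simp: comb_def)
      then show ?thesis using that by (auto simp: modulus_chi split: split_indicator)
    qed
    then have "N (chi (comb n)) = N (chi (comb 1))"
      using RI n by (auto simp: rearrangement_invariant_def M_chi comb_in_sets emeasure_comb)
    moreover have "amalgam_norm p q (chi (comb k)) = ennreal (real k powr d)" if "0 < k" for k
      using amalgam_norm_comb[OF assms that] by (simp add: d_def)
    ultimately have "ennreal (inverse C) * ennreal (real n powr d) \<le> ennreal C * ennreal 1"
      "ennreal (inverse C) * ennreal 1 \<le> ennreal C * ennreal (real n powr d)"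
      using lower[of "chi (comb n)"] upper[of "chi (comb n)"] n
        lower[of "chi (comb 1)"] upper[of "chi (comb 1)"]
      by (auto simp: M_chi comb_in_sets intro: order_trans)
    then show "inverse C * real n powr d \<le> C" "inverse C \<le> C * real n powr d"
      using C by (simp_all add: ennreal_mult[symmetric])
  qed
  have "d = 0"
  proof (rule ccontr)
    assume "d \<noteq> 0"
    \<comment> \<open>Multiplying \<open>bounds\<close> by \<open>C\<close> confines
      \<open>real n powr d\<close> and its reciprocal to at most \<open>C * C\<close>. The first
      fails for large \<open>n\<close> if \<open>d\<close> is positive, the second if it is
      negative.\<close>
    then obtain n :: nat where n: "0 < n" "C * C < real n powr \<bar>d\<bar>"
      using powr_unbounded[of "\<bar>d\<bar>" "C * C"] by auto
    show False
    proof (cases "0 < d")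
      case True
      then show False using bounds(1)[OF n(1)] n C by (simp add: field_simps)
    next
      case False
      then show False using bounds(2)[OF n(1)] n C by (simp add: field_simps powr_minus)
    qed
  qed
  \<comment> \<open>The map sending \<open>p\<close> to \<open>1 / enn2real p\<close> is injective
    on [1, \<infinity>]: only \<open>top\<close> goes to 0.\<close>
  then show "p = q"
    using assms by (cases p; cases q) (auto simp: d_def)
next
  assume "p = q"
  \<comment> \<open>The two functionals agree on \<open>M\<close>, so the constant 1 works.\<close>
  then have "equivalent (amalgam_norm p q) (Lp_norm p)"
    using assms by (auto simp: equivalent_def amalgam_norm_eq_Lp_norm intro!: exI[of _ 1])
  then show "\<exists>N. norm_on_M N \<and> rearrangement_invariant N \<and> equivalent (amalgam_norm p q) N"
    using assms norm_on_M_Lp_norm rearrangement_invariant_Lp_norm by blast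
qed (use assms in \<open>auto simp: amalgam_norm_eq_Lp_norm\<close>)

end
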